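(* Write $\bigvee\Delta$ for the disjunction of the formulae of $\Delta$ in a fixed association, with $\bigvee\emptyset=\bot$. For all finite multisets $\Gamma,\Delta$ of formulae, $\Gamma\Rightarrow\Delta$ is derivable in $\mathsf{G3T}^{i}$ if and only if $\Gamma\Rightarrow\bigvee\Delta$ is derivable in $\mathsf{G3ip}$. In particular the two calculi prove the same sequents with a single formula in the succedent, and $\mathsf{G3T}^{i}$ is a conservative extension of $\mathsf{G3ip}$.
   Context: Formulae are generated from a countable set of propositional variables by $A ::= p \mid \bot \mid A\land A \mid A\lor A \mid A\to A$. The calculus $\mathsf{G3T}^{i}$ (multiple succedent). Sequents $\Gamma\Rightarrow\Delta$ have $\Gamma,\Delta$ finite multisets of formulae. Initial sequents: $p,\Gamma\Rightarrow\Delta,p$ ($p$ a variable) and $\bot,\Gamma\Rightarrow\Delta$. Rules (premisses / conclusion): - $\land\mathrm L$: $A,B,\Gamma\Rightarrow\Delta$ / $A\land B,\Gamma\Rightarrow\Delta$. - $\lor\mathrm L$: $A,\Gamma\Rightarrow\Delta$ and $B,\Gamma\Rightarrow\Delta$ / $A\lor B,\Gamma\Rightarrow\Delta$. - $\to\!\mathrm L$: $A\to B,\Gamma\Rightarrow\Delta,A$ and $B,\Gamma\Rightarrow\Delta$ / $A\to B,\Gamma\Rightarrow\Delta$. - $\land\mathrm R$: $\Gamma\Rightarrow\Delta,A$ and $\Gamma\Rightarrow\Delta,B$ / $\Gamma\Rightarrow\Delta,A\land B$. - $\lor\mathrm R$: $\Gamma\Rightarrow\Delta,A,B$ / $\Gamma\Rightarrow\Delta,A\lor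 B$. - $\to\!\mathrm R$: $A,\Gamma\Rightarrow B$ / $\Gamma\Rightarrow\Delta,A\to B$. The calculus $\mathsf{G3ip}$ (single succedent). Sequents $\Gamma\Rightarrow C$ with $\Gamma$ a finite multiset and $C$ a formula. Initial sequents: $p,\Gamma\Rightarrow p$ ($p$ a variable) and $\bot,\Gamma\Rightarrow C$. Rules: - $A,B,\Gamma\Rightarrow C$ / $A\land B,\Gamma\Rightarrow C$. - $A,\Gamma\Rightarrow C$ and $B,\Gamma\Rightarrow C$ / $A\lor B,\Gamma\Rightarrow C$. - $A\to B,\Gamma\Rightarrow A$ and $B,\Gamma\Rightarrow C$ / $A\to B,\Gamma\Rightarrow C$. - $\Gamma\Rightarrow A$ and $\Gamma\Rightarrow B$ / $\Gamma\Rightarrow A\land B$. - $\Gamma\Rightarrow A$ / $\Gamma\Rightarrow A\lor B$; and $\Gamma\Rightarrow B$ / $\Gamma\Rightarrow A\lor B$. - $A,\Gamma\Rightarrow B$ / $\Gamma\Rightarrow A\to B$. *)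

theory Defs
  imports "HOL-Library.Multiset" "HOL-Library.Countable"
begin

datatype 'v form =
    Var 'v
  | Bot                        (\<open>\<^bold>\<bottom>\<close>)
  | And "'v form" "'v form"    (infixr \<open>\<^bold>\<and>\<close> 75)
  | Or "'v form" "'v form"     (infixr \<open>\<^bold>\<or>\<close> 70)
  | Imp "'v form" "'v form"    (infixr \<open>\<^bold>\<longrightarrow>\<close> 65)

text \<open>
  The multiple-succedent calculus: \<open>G3Ti \<Gamma> \<Delta>\<close> means that the sequent with antecedent \<open>\<Gamma>\<close> and
  succedent \<open>\<Delta>\<close> is derivable.  The premiss of \<open>ImpR\<close> has a single formula in its succedent.
\<close>

inductive G3Ti :: "'v form multiset \<Rightarrow> 'v form multiset \<Rightarrow> bool" where
  Ax: "G3Ti (add_mset (Var p) \<Gamma>) (add_mset (Var p) \<Delta>)"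
| BotL: "G3Ti (add_mset \<^bold>\<bottom> \<Gamma>) \<Delta>"
| AndL: "G3Ti (add_mset A (add_mset B \<Gamma>)) \<Delta> \<Longrightarrow> G3Ti (add_mset (A \<^bold>\<and> B) \<Gamma>) \<Delta>"
| OrL: "G3Ti (add_mset A \<Gamma>) \<Delta> \<Longrightarrow> G3Ti (add_mset B \<Gamma>) \<Delta> \<Longrightarrow> G3Ti (add_mset (A \<^bold>\<or> B) \<Gamma>) \<Delta>"
| ImpL: "G3Ti (add_mset (A \<^bold>\<longrightarrow> B) \<Gamma>) (add_mset A \<Delta>) \<Longrightarrow> G3Ti (add_mset B \<Gamma>) \<Delta>
    \<Longrightarrow> G3Ti (add_mset (A \<^bold>\<longrightarrow> B) \<Gamma>) \<Delta>"
| AndR: "G3Ti \<Gamma> (add_mset A \<Delta>) \<Longrightarrow> G3Ti \<Gamma> (add_mset B \<Delta>) \<Longrightarrow> G3Ti \<Gamma> (add_mset (A \<^bold>\<and> B) \<Delta>)"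
| OrR: "G3Ti \<Gamma> (add_mset A (add_mset B \<Delta>)) \<Longrightarrow> G3Ti \<Gamma> (add_mset (A \<^bold>\<or> B) \<Delta>)"
| ImpR: "G3Ti (add_mset A \<Gamma>) {#B#} \<Longrightarrow> G3Ti \<Gamma> (add_mset (A \<^bold>\<longrightarrow> B) \<Delta>)"

inductive G3ip :: "'v form multiset \<Rightarrow> 'v form \<Rightarrow> bool" where
  Ax: "G3ip (add_mset (Var p) \<Gamma>) (Var p)"
| BotL: "G3ip (add_mset \<^bold>\<bottom> \<Gamma>) C"
| AndL: "G3ip (add_mset A (add_mset B \<Gamma>)) C \<Longrightarrow> G3ip (add_mset (A \<^bold>\<and> B) \<Gamma>) C"
| OrL: "G3ip (add_mset A \<Gamma>) C \<Longrightarrow> G3ip (add_mset B \<Gamma>) C \<Longrightarrow> G3ip (add_mset (A \<^bold>\<or> B) \<Gamma>) C"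
| ImpL: "G3ip (add_mset (A \<^bold>\<longrightarrow> B) \<Gamma>) A \<Longrightarrow> G3ip (add_mset B \<Gamma>) C
    \<Longrightarrow> G3ip (add_mset (A \<^bold>\<longrightarrow> B) \<Gamma>) C"
| AndR: "G3ip \<Gamma> A \<Longrightarrow> G3ip \<Gamma> B \<Longrightarrow> G3ip \<Gamma> (A \<^bold>\<and> B)"
| OrR1: "G3ip \<Gamma> A \<Longrightarrow> G3ip \<Gamma> (A \<^bold>\<or> B)"
| OrR2: "G3ip \<Gamma> B \<Longrightarrow> G3ip \<Gamma> (A \<^bold>\<or> B)"
| ImpR: "G3ip (add_mset A \<Gamma>) B \<Longrightarrow> G3ip \<Gamma> (A \<^bold>\<longrightarrow> B)"

text \<open>
  Disjunction of finitely many formulae, associated to the right; the disjunction of a single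
  formula is that formula.  A multiset carries no order, so the function is defined on lists, and
  a disjunction of a multiset is the value at any of its enumerations.
\<close>

fun big_or :: "'v form list \<Rightarrow> 'v form" where
  "big_or [] = \<^bold>\<bottom>"
| "big_or [A] = A"
| "big_or (A # B # As) = A \<^bold>\<or> big_or (B # As)"

text \<open>
  Conservativity of a calculus \<open>T\<close> over a calculus \<open>S\<close>, both given by their derivable sequents,
  relative to an embedding \<open>i\<close> of the sequents of \<open>S\<close> into those of \<open>T\<close>: the first conjunct is
  extension, the second conservativity.
\<close>

definition conservative_extension :: "('s \<Rightarrow> 't) \<Rightarrow> ('s \<Rightarrow> bool) \<Rightarrow> ('t \<Rightarrow> bool) \<Rightarrow> bool" where
  "conservative_extension i S T \<longleftrightarrow> (\<forall>s. S s \<longrightarrow> T (i s)) \<and> (\<forall>s. T (i s) \<longrightarrow> S s)"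

end

theory Submission
  imports Defs
begin

text \<open>
  Both directions are proved by a single induction on derivations, cut-free, once the formula
  \<open>\<Or>\<Delta>\<close> is replaced by its relation to \<open>\<Delta>\<close>, which does not depend on an order of \<open>\<Delta>\<close>.

  From single to multiple succedents, a formula \<open>C\<close> on the right may be dissolved into any \<open>\<Delta>\<close>
  that contains every piece left when \<open>C\<close> is split at some of its outer disjunctions and
  occurrences of \<open>\<^bold>\<bottom>\<close> are dropped (\<open>covered\<close>).  Every right rule of \<open>G3ip\<close> respects this relation,
  so weakening and the inversion of disjunction on the right come for free
  (\<open>G3Ti_of_G3ip\<close>).

  From multiple to single succedents, \<open>\<Gamma> \<Rightarrow> \<Delta>\<close> yields \<open>\<Gamma> \<Rightarrow> C\<close> for each \<open>C\<close> that has all members of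
  \<open>\<Delta>\<close> among its disjuncts (\<open>G3ip_of_G3Ti\<close>).  The rules that keep a context \<open>\<Delta>\<close> next to an active
  formula \<open>A\<close> need thought: the induction hypothesis for \<open>\<Gamma> \<Rightarrow> \<Delta>, A\<close> gives \<open>\<Gamma> \<Rightarrow> C \<or> A\<close>, and one
  has to get back to \<open>C\<close>.  In \<open>G3ip\<close> a derivation of a disjunction is a tree of left rules whose
  leaves, apart from initial sequents and left premisses of implication rules, prove one of the
  two disjuncts.  At these leaves the derivation can be
  continued towards \<open>C\<close>, provided that the other premisses of the rule are still available over
  the antecedents found there; they are, because the left rules are invertible
  (\<open>G3ip_disj_elim\<close>, \<open>left_stable_G3ip\<close>).
\<close>

section \<open>Invertibility of the left rules of the single-succedent calculus\<close>

text \<open>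
  \<open>left_reduct X M\<close> says that some premiss of the left rule for \<open>X\<close> that keeps the succedent has
  \<open>M\<close> in place of \<open>X\<close>.  These are exactly the premisses with respect to which the rules are
  invertible; the left premiss of the implication rule is not among them.
\<close>

inductive left_reduct :: "'v form \<Rightarrow> 'v form multiset \<Rightarrow> bool" where
  And: "left_reduct (A \<^bold>\<and> B) {#A, B#}"
| Or1: "left_reduct (A \<^bold>\<or> B) {#A#}"
| Or2: "left_reduct (A \<^bold>\<or> B) {#B#}"
| Imp: "left_reduct (A \<^bold>\<longrightarrow> B) {#B#}"

inductive_simps left_reduct_simps [simp]:
  "left_reduct (Var p) M" "left_reduct \<^bold>\<bottom> M" "left_reduct (A \<^bold>\<and> B) M"
  "left_reduct (A \<^bold>\<or> B) M" "left_reduct (A \<^bold>\<longrightarrow> B) M"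

definition left_stable :: "('v form multiset \<Rightarrow> bool) \<Rightarrow> bool" where
  "left_stable K \<longleftrightarrow> (\<forall>X M \<Gamma>. left_reduct X M \<longrightarrow> K (add_mset X \<Gamma>) \<longrightarrow> K (M + \<Gamma>))"

lemma left_stableD: "left_stable K \<Longrightarrow> left_reduct X M \<Longrightarrow> K (add_mset X \<Gamma>) \<Longrightarrow> K (M + \<Gamma>)"
  by (auto simp: left_stable_def)

lemma left_stable_AndD: "left_stable K \<Longrightarrow> K (add_mset (A \<^bold>\<and> B) \<Gamma>) \<Longrightarrow> K (add_mset A (add_mset B \<Gamma>))"
  using left_stableD[OF _ left_reduct.And] by fastforce

lemma left_stable_OrD1: "left_stable K \<Longrightarrow> K (add_mset (A \<^bold>\<or> B) \<Gamma>) \<Longrightarrow> K (add_mset A \<Gamma>)"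
  using left_stableD[OF _ left_reduct.Or1] by fastforce

lemma left_stable_OrD2: "left_stable K \<Longrightarrow> K (add_mset (A \<^bold>\<or> B) \<Gamma>) \<Longrightarrow> K (add_mset B \<Gamma>)"
  using left_stableD[OF _ left_reduct.Or2] by fastforce

lemma left_stable_ImpD: "left_stable K \<Longrightarrow> K (add_mset (A \<^bold>\<longrightarrow> B) \<Gamma>) \<Longrightarrow> K (add_mset B \<Gamma>)"
  using left_stableD[OF _ left_reduct.Imp] by fastforce

text \<open>
  If \<open>X\<close> is principal in the last rule, the wanted derivation is one of its immediate
  subderivations; otherwise \<open>X\<close> lies in the context of every premiss, where it is replaced by \<open>M\<close>
  before the rule is applied again.
\<close>

lemma G3ip_left_inversion:
  assumes "G3ip (add_mset X \<Gamma>) C" "left_reduct X M"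
  shows "G3ip (M + \<Gamma>) C"
  using assms
proof (induction "add_mset X \<Gamma>" C arbitrary: \<Gamma> rule: G3ip.induct)
  case (Ax p \<Gamma>')
  then obtain \<Gamma>1 where "\<Gamma> = add_mset (Var p) \<Gamma>1"
    by (auto simp: add_eq_conv_ex)
  then show ?case by (simp add: G3ip.Ax)
next
  case (BotL \<Gamma>' C)
  then obtain \<Gamma>1 where "\<Gamma> = add_mset \<^bold>\<bottom> \<Gamma>1"
    by (auto simp: add_eq_conv_ex)
  then show ?case by (simp add: G3ip.BotL)
next
  case (AndL A B \<Gamma>' C)
  show ?case
  proof (cases "X = A \<^bold>\<and> B")
    case True
    with AndL show ?thesis by auto
  next
    case False
    with AndL.hyps(3) obtain \<Gamma>1 where \<Gamma>1: "\<Gamma>' = add_mset X \<Gamma>1" "\<Gamma> = add_mset (A \<^bold>\<and> B) \<Gamma>1"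
      by (auto simp: add_eq_conv_ex)
    have "G3ip (M + add_mset A (add_mset B \<Gamma>1)) C"
      by (rule AndL.hyps(2)) (use \<Gamma>1 AndL.prems in \<open>auto simp: add_mset_commute\<close>)
    then show ?thesis using \<Gamma>1 by (simp add: G3ip.AndL)
  qed
next
  case (OrL A \<Gamma>' C B)
  show ?case
  proof (cases "X = A \<^bold>\<or> B")
    case True
    with OrL show ?thesis by auto
  next
    case False
    with OrL.hyps(5) obtain \<Gamma>1 where \<Gamma>1: "\<Gamma>' = add_mset X \<Gamma>1" "\<Gamma> = add_mset (A \<^bold>\<or> B) \<Gamma>1"
      by (auto simp: add_eq_conv_ex)
    have "G3ip (M + add_mset A \<Gamma>1) C"
      by (rule OrL.hyps(2)) (use \<Gamma>1 OrL.prems in \<open>auto simp: add_mset_commute\<close>)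
    moreover have "G3ip (M + add_mset B \<Gamma>1) C"
      by (rule OrL.hyps(4)) (use \<Gamma>1 OrL.prems in \<open>auto simp: add_mset_commute\<close>)
    ultimately show ?thesis using \<Gamma>1 by (simp add: G3ip.OrL)
  qed
next
  case (ImpL A B \<Gamma>' C)
  show ?case
  proof (cases "X = A \<^bold>\<longrightarrow> B")
    case True
    with ImpL show ?thesis by auto
  next
    case False
    with ImpL.hyps(5) obtain \<Gamma>1 where \<Gamma>1: "\<Gamma>' = add_mset X \<Gamma>1" "\<Gamma> = add_mset (A \<^bold>\<longrightarrow> B) \<Gamma>1"
      by (auto simp: add_eq_conv_ex)
    have "G3ip (M + add_mset (A \<^bold>\<longrightarrow> B) \<Gamma>1) A"
      by (rule ImpL.hyps(2)) (use \<Gamma>1 ImpL.prems in \<open>auto simp: add_mset_commute\<close>)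
    moreover have "G3ip (M + add_mset B \<Gamma>1) C"
      by (rule ImpL.hyps(4)) (use \<Gamma>1 ImpL.prems in \<open>auto simp: add_mset_commute\<close>)
    ultimately show ?thesis using \<Gamma>1 by (simp add: G3ip.ImpL)
  qed
next
  case (ImpR A B)
  have "G3ip (M + add_mset A \<Gamma>) B"
    by (rule ImpR.hyps(2)) (use ImpR.prems in \<open>auto simp: add_mset_commute\<close>)
  then show ?case by (simp add: G3ip.ImpR)
qed (auto intro: G3ip.AndR G3ip.OrR1 G3ip.OrR2)

lemma left_stable_G3ip: "left_stable (\<lambda>\<Gamma>. G3ip \<Gamma> C)"
  by (auto simp: left_stable_def intro: G3ip_left_inversion)

text \<open>
  The premisses of an implication-left inference survive inversion only in this disjunctive form:
  as soon as the implication itself is reduced to \<open>B\<close>, its right premiss already is the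
  conclusion that is wanted.
\<close>

lemma left_stable_ImpL:
  "left_stable (\<lambda>\<Gamma>. G3ip \<Gamma> C \<or> (\<exists>\<Gamma>'. \<Gamma> = add_mset (A \<^bold>\<longrightarrow> B) \<Gamma>' \<and> G3ip (add_mset B \<Gamma>') C))"
  (is "left_stable ?K")
proof -
  have "?K (M + \<Gamma>)" if X: "left_reduct X M" and K: "?K (add_mset X \<Gamma>)" for X M \<Gamma>
    using K
  proof
    assume "G3ip (add_mset X \<Gamma>) C"
    with X show ?thesis by (simp add: G3ip_left_inversion)
  next
    assume "\<exists>\<Gamma>'. add_mset X \<Gamma> = add_mset (A \<^bold>\<longrightarrow> B) \<Gamma>' \<and> G3ip (add_mset B \<Gamma>') C"
    then obtain \<Gamma>' where \<Gamma>': "add_mset X \<Gamma> = add_mset (A \<^bold>\<longrightarrow> B) \<Gamma>'" "G3ip (add_mset B \<Gamma>') C"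
      by blast
    show ?thesis
    proof (cases "X = A \<^bold>\<longrightarrow> B")
      case True
      with X \<Gamma>' show ?thesis by simp
    next
      case False
      with \<Gamma>'(1) obtain \<Gamma>1 where \<Gamma>1: "\<Gamma>' = add_mset X \<Gamma>1" "\<Gamma> = add_mset (A \<^bold>\<longrightarrow> B) \<Gamma>1"
        by (auto simp: add_eq_conv_ex)
      with \<Gamma>'(2) have "G3ip (add_mset X (add_mset B \<Gamma>1)) C"
        by (simp add: add_mset_commute)
      from G3ip_left_inversion[OF this X] \<Gamma>1 show ?thesis by auto
    qed
  qed
  then show ?thesis unfolding left_stable_def by blast
qed

text \<open>
  This takes the place of a cut on \<open>A \<^bold>\<or> B\<close>.  The induction follows the derivation of the
  disjunction through its left rules to the inferences that introduce it, carrying the side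
  information \<open>K\<close> along; the left premiss of an implication rule proves another formula and is
  reused unchanged.
\<close>

lemma G3ip_disj_elim:
  assumes "G3ip \<Gamma> (A \<^bold>\<or> B)" and "K \<Gamma>" and K: "left_stable K"
    and A: "\<And>\<Gamma>. K \<Gamma> \<Longrightarrow> G3ip \<Gamma> A \<Longrightarrow> G3ip \<Gamma> C"
    and B: "\<And>\<Gamma>. K \<Gamma> \<Longrightarrow> G3ip \<Gamma> B \<Longrightarrow> G3ip \<Gamma> C"
  shows "G3ip \<Gamma> C"
  using assms(1,2)
proof (induction \<Gamma> "A \<^bold>\<or> B" rule: G3ip.induct)
  case BotL
  show ?case by (rule G3ip.BotL)
next
  case AndL
  then show ?case by (blast intro: G3ip.AndL left_stable_AndD[OF K])
next
  case OrL
  then show ?case by (blast intro: G3ip.OrL left_stable_OrD1[OF K] left_stable_OrD2[OF K])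
next
  case ImpL
  then show ?case by (blast intro: G3ip.ImpL left_stable_ImpD[OF K])
qed (auto intro: A B)

section \<open>From multiple to single succedents\<close>

inductive disjunct_of :: "'v form \<Rightarrow> 'v form \<Rightarrow> bool" for D where
  refl: "disjunct_of D D"
| left: "disjunct_of D A \<Longrightarrow> disjunct_of D (A \<^bold>\<or> B)"
| right: "disjunct_of D B \<Longrightarrow> disjunct_of D (A \<^bold>\<or> B)"

lemma disjunct_of_OrD:
  "disjunct_of (A \<^bold>\<or> B) C \<Longrightarrow> disjunct_of A C \<and> disjunct_of B C"
  by (induction rule: disjunct_of.induct) (auto intro: disjunct_of.intros)

lemma G3ip_disjunct: "disjunct_of D C \<Longrightarrow> G3ip \<Gamma> D \<Longrightarrow> G3ip \<Gamma> C"
  by (induction rule: disjunct_of.induct) (auto intro: G3ip.OrR1 G3ip.OrR2)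

lemma G3ip_ImpL_disj:
  assumes "G3ip (add_mset (A \<^bold>\<longrightarrow> B) \<Gamma>) (C \<^bold>\<or> A)" "G3ip (add_mset B \<Gamma>) C"
  shows "G3ip (add_mset (A \<^bold>\<longrightarrow> B) \<Gamma>) C"
  using assms(1) _ left_stable_ImpL[of C A B]
  by (rule G3ip_disj_elim) (use assms(2) in \<open>auto intro: G3ip.ImpL\<close>)

text \<open>
  Two eliminations, one inside the other: the first reaches antecedents that prove \<open>A\<close>, keeping
  the derivability of \<open>C \<^bold>\<or> B\<close>, and the second goes on to antecedents that prove \<open>B\<close>, keeping that
  of \<open>A\<close>.
\<close>

lemma G3ip_AndR_disj:
  assumes "G3ip \<Gamma> (C \<^bold>\<or> A)" "G3ip \<Gamma> (C \<^bold>\<or> B)" and C: "disjunct_of (A \<^bold>\<and> B) C"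
  shows "G3ip \<Gamma> C"
  using assms(1,2) left_stable_G3ip
proof (rule G3ip_disj_elim)
  fix \<Gamma>
  assume "G3ip \<Gamma> (C \<^bold>\<or> B)" "G3ip \<Gamma> A"
  then show "G3ip \<Gamma> C"
    using left_stable_G3ip
    by (rule G3ip_disj_elim) (auto intro: G3ip_disjunct[OF C] G3ip.AndR)
qed

text \<open>
  The succedent is generalised to any formula with the members of \<open>\<Delta>\<close> as disjuncts so that the
  induction hypotheses can be used with \<open>C \<^bold>\<or> A\<close> for the premisses with an active formula \<open>A\<close>, while
  disjunction-right needs no change of \<open>C\<close>.
\<close>

lemma G3ip_of_G3Ti:
  assumes "G3Ti \<Gamma> \<Delta>" "\<forall>D\<in>#\<Delta>. disjunct_of D C"
  shows "G3ip \<Gamma> C"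
  using assms
proof (induction arbitrary: C rule: G3Ti.induct)
  case (Ax p \<Gamma> \<Delta>)
  then show ?case by (auto intro: G3ip_disjunct[of "Var p"] G3ip.Ax)
next
  case (ImpL A B \<Gamma> \<Delta>)
  have "G3ip (add_mset (A \<^bold>\<longrightarrow> B) \<Gamma>) (C \<^bold>\<or> A)"
    by (rule ImpL.IH(1)) (use ImpL.prems in \<open>auto intro: disjunct_of.intros\<close>)
  with ImpL show ?case by (blast intro: G3ip_ImpL_disj)
next
  case (AndR \<Gamma> A \<Delta> B)
  have "G3ip \<Gamma> (C \<^bold>\<or> A)"
    by (rule AndR.IH(1)) (use AndR.prems in \<open>auto intro: disjunct_of.intros\<close>)
  moreover have "G3ip \<Gamma> (C \<^bold>\<or> B)"
    by (rule AndR.IH(2)) (use AndR.prems in \<open>auto intro: disjunct_of.intros\<close>)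
  ultimately show ?case
    by (rule G3ip_AndR_disj) (use AndR.prems in simp)
next
  case (OrR \<Gamma> A B \<Delta>)
  then show ?case by (auto dest: disjunct_of_OrD)
next
  case (ImpR A \<Gamma> B \<Delta>)
  then have "G3ip \<Gamma> (A \<^bold>\<longrightarrow> B)"
    by (auto intro: G3ip.ImpR disjunct_of.refl)
  with ImpR.prems show ?case by (auto intro: G3ip_disjunct)
qed (auto intro: G3ip.intros)

section \<open>From single to multiple succedents\<close>

text \<open>
  Covering is weaker than having all disjuncts in \<open>\<Delta>\<close>: a disjunction may be a member of \<open>\<Delta>\<close> as a
  whole, and \<open>\<^bold>\<bottom>\<close> is always covered, which accounts for the empty succedent.
\<close>

inductive covered :: "'v form multiset \<Rightarrow> 'v form \<Rightarrow> bool" for \<Delta> where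
  mem: "C \<in># \<Delta> \<Longrightarrow> covered \<Delta> C"
| Bot: "covered \<Delta> \<^bold>\<bottom>"
| Or: "covered \<Delta> A \<Longrightarrow> covered \<Delta> B \<Longrightarrow> covered \<Delta> (A \<^bold>\<or> B)"

inductive_simps covered_simps:
  "covered \<Delta> (Var p)" "covered \<Delta> (A \<^bold>\<and> B)" "covered \<Delta> (A \<^bold>\<or> B)" "covered \<Delta> (A \<^bold>\<longrightarrow> B)"

lemma G3Ti_OrR_covered:
  assumes cov: "covered \<Delta> (A \<^bold>\<or> B)" and D: "D = A \<or> D = B"
    and G3Ti: "\<And>\<Delta>. covered \<Delta> D \<Longrightarrow> G3Ti \<Gamma> \<Delta>"
  shows "G3Ti \<Gamma> \<Delta>"
proof (cases "A \<^bold>\<or> B \<in># \<Delta>")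
  case True
  then obtain \<Delta>' where \<Delta>': "\<Delta> = add_mset (A \<^bold>\<or> B) \<Delta>'"
    by (meson mset_add)
  have "G3Ti \<Gamma> (add_mset A (add_mset B \<Delta>'))"
    by (rule G3Ti) (use D in \<open>auto intro: covered.mem\<close>)
  then show ?thesis unfolding \<Delta>' by (rule G3Ti.OrR)
next
  case False
  with cov D show ?thesis by (auto simp: covered_simps intro: G3Ti)
qed

text \<open>
  The succedent is universally quantified in the induction, which builds weakening on the right
  into the statement: the left premiss of an implication rule is used with its formula added to
  \<open>\<Delta>\<close>.  A conjunction or implication introduced by the last rule is covered only as a member of
  \<open>\<Delta>\<close>, so that the corresponding rule of \<open>G3Ti\<close> applies to it there.
\<close>

lemma G3Ti_of_G3ip:
  assumes "G3ip \<Gamma> C" "covered \<Delta> C"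
  shows "G3Ti \<Gamma> \<Delta>"
  using assms
proof (induction arbitrary: \<Delta> rule: G3ip.induct)
  case (Ax p \<Gamma>)
  then show ?case by (auto simp: covered_simps G3Ti.Ax dest!: multi_member_split)
next
  case (ImpL A B \<Gamma> C)
  then show ?case by (simp add: G3Ti.ImpL covered.mem)
next
  case (AndR \<Gamma> A B)
  then show ?case
    by (auto simp: covered_simps covered.mem dest!: multi_member_split intro!: G3Ti.AndR)
next
  case (OrR1 \<Gamma> A B)
  then show ?case by (blast intro: G3Ti_OrR_covered)
next
  case (OrR2 \<Gamma> B A)
  then show ?case by (blast intro: G3Ti_OrR_covered)
next
  case (ImpR A \<Gamma> B)
  then show ?case
    by (auto simp: covered_simps covered.mem dest!: multi_member_split intro!: G3Ti.ImpR)
qed (auto intro: G3Ti.intros)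

section \<open>Disjunctions of multisets\<close>

lemma disjunct_of_big_or: "D \<in> set Ds \<Longrightarrow> disjunct_of D (big_or Ds)"
  by (induction Ds rule: big_or.induct) (auto intro: disjunct_of.intros)

lemma covered_big_or: "set Ds \<subseteq> set_mset \<Delta> \<Longrightarrow> covered \<Delta> (big_or Ds)"
  by (induction Ds rule: big_or.induct) (auto intro: covered.intros)

lemma G3Ti_iff_G3ip_big_or: "G3Ti \<Gamma> (mset Ds) \<longleftrightarrow> G3ip \<Gamma> (big_or Ds)"
proof
  show "G3Ti \<Gamma> (mset Ds) \<Longrightarrow> G3ip \<Gamma> (big_or Ds)"
    by (erule G3ip_of_G3Ti) (simp add: disjunct_of_big_or)
  show "G3ip \<Gamma> (big_or Ds) \<Longrightarrow> G3Ti \<Gamma> (mset Ds)"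
    by (erule G3Ti_of_G3ip) (simp add: covered_big_or)
qed

lemma G3Ti_singleton_iff_G3ip: "G3Ti \<Gamma> {#C#} \<longleftrightarrow> G3ip \<Gamma> C"
  using G3Ti_iff_G3ip_big_or[of \<Gamma> "[C]"] by simp

theorem proposition5p14:
  "(\<forall>(\<Gamma> :: 'v::countable form multiset) \<Delta> Ds. mset Ds = \<Delta> \<longrightarrow>
      (G3Ti \<Gamma> \<Delta> \<longleftrightarrow> G3ip \<Gamma> (big_or Ds)))
   \<and> (\<forall>(\<Gamma> :: 'v form multiset) C. G3Ti \<Gamma> {#C#} \<longleftrightarrow> G3ip \<Gamma> C)
   \<and> conservative_extension
       (\<lambda>(\<Gamma> :: 'v form multiset, C). (\<Gamma>, {#C#}))
       (\<lambda>(\<Gamma>, C). G3ip \<Gamma> C)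
       (\<lambda>(\<Gamma>, \<Delta>). G3Ti \<Gamma> \<Delta>)"
  unfolding conservative_extension_def
  by (auto simp: G3Ti_iff_G3ip_big_or G3Ti_singleton_iff_G3ip)

end
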